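(* Let $V\hookrightarrow X\hookrightarrow V'$ be a Hilbert triple, let $Y$ be a Hilbert space, and let $A=A_0+\gamma A_1 : X\to Y$, where $A_0:X\to Y$ is a bounded linear operator, $A_1:X\to Y$ is continuously Fréchet differentiable on $X$, and $\gamma>0$ is a (small) real number. Let $\mu\in V'$, let $\epsilon>0$, and let $y,y_\epsilon\in Y$ with $\|y-y_\epsilon\|_Y\le\epsilon$. Let $x^*\in V$ be a solution of $A x^*=y$, and let $x^0\in V$ be an (arbitrary) approximation to $x^*$. For $\varphi\in Y$ set $$ f:=\langle \mu,x^*\rangle_X,\qquad f_{\epsilon,\varphi}:=\langle \varphi,y_\epsilon\rangle_Y .$$ Then for every $\varphi \in Y$ $$\begin{aligned} |f-f_{\epsilon,\varphi}| \le{}& |\langle\varphi,y-y_\epsilon\rangle_Y| + |\langle\varphi,\,A x^*-A x^0-dA(x^0)(x^*-x^0)\rangle_Y| \\ &+|\langle\varphi,\,A x^0-dA(x^0)x^0\rangle_Y| + |\langle dA(x^0)^*\varphi-\mu,\,x^*\rangle_X| . \end{aligned}$$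
   Context: A Hilbert triple $V\hookrightarrow X\hookrightarrow V'$ consists of Hilbert spaces $V$ and $X$ with $V$ continuously and densely embedded in $X$; $X$ is identified with its dual $X'$, and hence embedded in the dual $V'$ of $V$. The space $Y$ is identified with its dual $Y'$. The symbol $\langle\cdot,\cdot\rangle_Y$ is the inner product of $Y$. The symbol $\langle\cdot,\cdot\rangle_X$ denotes the inner product of $X$ and also its extension to the duality pairing between $V'$ and $V$ (so $\langle\mu,x\rangle_X$ is the value of $\mu\in V'$ at $x\in V$). $dA(x^0)=A_0+\gamma\, dA_1(x^0)$ is the Fréchet derivative of $A$ at $x^0$, a bounded linear operator $X\to Y$, and $dA(x^0)^*:Y\to X$ is its adjoint. *)

theory Defs
  imports "HOL-Analysis.Analysis"
begin

text \<open>
  Hilbert spaces are real: types of sort \<open>{real_inner, complete_space}\<close>. The embedding of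
  \<open>V\<close> in \<open>X\<close> is an explicit map \<open>\<iota>\<close>; continuity and linearity are part of its type. The dual
  \<open>V'\<close> is \<open>'v \<Rightarrow>\<^sub>L real\<close>, and the duality pairing of \<open>\<mu>\<close> and \<open>x\<close> is \<open>blinfun_apply \<mu> x\<close>.
\<close>

definition hilbert_triple ::
  "('v::{real_inner, complete_space} \<Rightarrow>\<^sub>L 'x::{real_inner, complete_space}) \<Rightarrow> bool"
  where "hilbert_triple \<iota> \<longleftrightarrow>
    inj (blinfun_apply \<iota>) \<and> closure (range (blinfun_apply \<iota>)) = UNIV"

text \<open>
  The embedding \<open>X \<hookrightarrow> V'\<close> obtained from \<open>X = X'\<close>: the functional \<open>v \<mapsto> \<langle>x, \<iota> v\<rangle>\<close> on \<open>V\<close>.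
  With this embedding the duality pairing extends the inner product of \<open>X\<close>.
\<close>

definition to_dual ::
  "('v::{real_inner, complete_space} \<Rightarrow>\<^sub>L 'x::{real_inner, complete_space}) \<Rightarrow> 'x \<Rightarrow> ('v \<Rightarrow>\<^sub>L real)"
  where "to_dual \<iota> x = blinfun_inner_right x o\<^sub>L \<iota>"

lemma to_dual_apply [simp]: "blinfun_apply (to_dual \<iota> x) v = inner x (blinfun_apply \<iota> v)"
  by (simp add: to_dual_def)

lemma inj_to_dual:
  assumes "hilbert_triple \<iota>"
  shows "inj (to_dual \<iota>)"
proof (rule injI)
  fix x x' assume eq: "to_dual \<iota> x = to_dual \<iota> x'"
  have "inner (x - x') w = 0" for w
  proof -
    have "closed {w. inner (x - x') w = 0}"
      by (intro closed_Collect_eq continuous_intros)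
    moreover have "inner (x - x') (blinfun_apply \<iota> v) = 0" for v
      using arg_cong [OF eq, of "\<lambda>T. blinfun_apply T v"] by (simp add: inner_diff_left)
    ultimately have "closure (range (blinfun_apply \<iota>)) \<subseteq> {w. inner (x - x') w = 0}"
      by (intro closure_minimal) auto
    then show ?thesis
      using assms by (auto simp: hilbert_triple_def)
  qed
  then show "x = x'"
    by (metis eq_iff_diff_eq_0 inner_eq_zero_iff)
qed

definition continuously_frechet_differentiable ::
  "('x::real_normed_vector \<Rightarrow> 'y::real_normed_vector) \<Rightarrow> bool"
  where "continuously_frechet_differentiable f \<longleftrightarrow>
    (\<exists>f' :: 'x \<Rightarrow> ('x \<Rightarrow>\<^sub>L 'y).
      (\<forall>x. (f has_derivative blinfun_apply (f' x)) (at x)) \<and> continuous_on UNIV f')"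

lemma frechet_derivative_perturbed:
  assumes "continuously_frechet_differentiable A\<^sub>1"
  shows "((\<lambda>x. blinfun_apply A\<^sub>0 x + \<gamma> *\<^sub>R A\<^sub>1 x) has_derivative
           (\<lambda>h. blinfun_apply A\<^sub>0 h + \<gamma> *\<^sub>R frechet_derivative A\<^sub>1 (at x) h)) (at x)"
    and "frechet_derivative (\<lambda>x. blinfun_apply A\<^sub>0 x + \<gamma> *\<^sub>R A\<^sub>1 x) (at x) =
           (\<lambda>h. blinfun_apply A\<^sub>0 h + \<gamma> *\<^sub>R frechet_derivative A\<^sub>1 (at x) h)"
proof -
  have "A\<^sub>1 differentiable at x"
    using assms by (auto simp: continuously_frechet_differentiable_def differentiable_def)
  then have d: "(A\<^sub>1 has_derivative frechet_derivative A\<^sub>1 (at x)) (at x)"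
    by (rule frechet_derivative_works [THEN iffD1])
  show *: "((\<lambda>x. blinfun_apply A\<^sub>0 x + \<gamma> *\<^sub>R A\<^sub>1 x) has_derivative
           (\<lambda>h. blinfun_apply A\<^sub>0 h + \<gamma> *\<^sub>R frechet_derivative A\<^sub>1 (at x) h)) (at x)"
    by (rule has_derivative_add
        [OF bounded_linear_imp_has_derivative [OF blinfun.bounded_linear_right]
            has_derivative_scaleR_right [OF d]])
  show "frechet_derivative (\<lambda>x. blinfun_apply A\<^sub>0 x + \<gamma> *\<^sub>R A\<^sub>1 x) (at x) =
           (\<lambda>h. blinfun_apply A\<^sub>0 h + \<gamma> *\<^sub>R frechet_derivative A\<^sub>1 (at x) h)"
    by (rule frechet_derivative_at [OF *, symmetric])
qed

end

(* The right-hand side is a telescoping decomposition of \<langle>\<mu>, x*\<rangle> - \<langle>\<phi>, y_eps\<rangle>, once the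
   adjoint of dA(x0) is known to satisfy its defining identity. The library's adjoint is a
   Hilbert choice, known to exist only in finite dimensions; in a Hilbert space existence follows
   from the Riesz representation theorem. The representing vector of \<phi> is obtained as the
   minimiser of x \<mapsto> |x|^2 / 2 - \<phi> x. *)
theory Submission
  imports Defs
begin

text \<open>The parallelogram law makes a minimising sequence Cauchy, so completeness supplies a
  minimiser \<open>u\<close>. Minimality along each line through \<open>u\<close> then forces the
  directional derivative \<open>inner u h - \<phi> h\<close> to vanish.\<close>

lemma riesz_representation:
  fixes \<phi> :: "'a::{real_inner, complete_space} \<Rightarrow> real"
  assumes "bounded_linear \<phi>"
  obtains u where "\<And>x. \<phi> x = inner u x"
proof -
  interpret \<phi>: bounded_linear \<phi> by fact
  define J where "J x = inner x x / 2 - \<phi> x" for x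
  define m where "m = (INF x. J x)"
  obtain K where K: "\<And>x. norm (\<phi> x) \<le> norm x * K"
    using \<phi>.bounded by blast
  \<comment> \<open>Complete the square: |x|^2 / 2 - K |x| = (|x| - K)^2 / 2 - K^2 / 2.\<close>
  have "- K\<^sup>2 / 2 \<le> J x" for x
  proof -
    have "\<phi> x \<le> norm x * K"
      using K [of x] by simp
    moreover have "0 \<le> (norm x - K)\<^sup>2"
      by simp
    ultimately show ?thesis
      by (simp add: J_def power2_diff flip: power2_norm_eq_inner)
  qed
  then have bdd: "bdd_below (range J)"
    by (intro bdd_belowI2)
  then have m_le: "m \<le> J x" for x
    unfolding m_def by (rule cINF_lower) simp
  \<comment> \<open>The linear part of \<open>J\<close> cancels at the midpoint, which leaves the
    parallelogram law for the quadratic part.\<close>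
  have parallelogram: "(norm (a - b))\<^sup>2 / 4 = J a + J b - 2 * J ((1/2) *\<^sub>R (a + b))" for a b
    by (simp add: J_def power2_norm_eq_inner inner_simps inner_commute \<phi>.add \<phi>.scaleR field_simps)
  have "\<exists>x. J x < m + inverse (Suc n)" for n
  proof -
    have "(INF x. J x) < m + inverse (Suc n)"
      unfolding m_def by simp
    then show ?thesis
      using bdd by (simp add: cINF_less_iff)
  qed
  then obtain X where X: "\<And>n. J (X n) < m + inverse (Suc n)"
    by metis
  have "Cauchy X"
  proof (rule metric_CauchyI)
    fix e :: real
    assume "0 < e"
    \<comment> \<open>Two values of \<open>J\<close> within e^2 / 8 of \<open>m\<close>, with the
      midpoint value at least \<open>m\<close>, give |a - b|^2 / 4 < e^2 / 4.\<close>
    then obtain N where N: "inverse (Suc N) < e\<^sup>2 / 8"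
      using reals_Archimedean [of "e\<^sup>2 / 8"] by auto
    have "dist (X k) (X n) < e" if "k \<ge> N" "n \<ge> N" for k n
    proof -
      have near: "J (X i) < m + e\<^sup>2 / 8" if "i \<ge> N" for i
      proof -
        have "inverse (real (Suc i)) \<le> inverse (real (Suc N))"
          using that by (intro le_imp_inverse_le) auto
        then show ?thesis
          using X [of i] N by linarith
      qed
      have "(norm (X k - X n))\<^sup>2 < e\<^sup>2"
        using parallelogram [of "X k" "X n"] near [OF \<open>k \<ge> N\<close>] near [OF \<open>n \<ge> N\<close>]
          m_le [of "(1/2) *\<^sub>R (X k + X n)"] by linarith
      then show ?thesis
        using \<open>0 < e\<close> by (simp add: dist_norm power2_less_imp_less)
    qed
    then show "\<exists>M. \<forall>k\<ge>M. \<forall>n\<ge>M. dist (X k) (X n) < e"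
      by blast
  qed
  then obtain u where u: "X \<longlonglongrightarrow> u"
    using Cauchy_convergent convergent_def by blast
  have "(\<lambda>n. J (X n)) \<longlonglongrightarrow> J u"
    unfolding J_def by (intro tendsto_intros \<phi>.tendsto u) simp
  moreover have "(\<lambda>n. m + inverse (Suc n)) \<longlonglongrightarrow> m"
    using LIMSEQ_inverse_real_of_nat_add .
  ultimately have "J u \<le> m"
    by (rule LIMSEQ_le) (use X less_imp_le in blast)
  have "\<phi> h = inner u h" for h
  proof (cases "h = 0")
    case False
    define d where "d = inner u h - \<phi> h"
    \<comment> \<open>This \<open>t\<close> minimises the quadratic t d + t^2 |h|^2 / 2. Its minimum
      there, - d^2 / (2 |h|^2), cannot be negative because \<open>u\<close> minimises
      \<open>J\<close>; hence d = 0.\<close>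
    define t where "t = - d / inner h h"
    have "J (u + t *\<^sub>R h) - J u = t * d + t\<^sup>2 * inner h h / 2"
      by (simp add: J_def d_def inner_simps inner_commute \<phi>.add \<phi>.scaleR field_simps power2_eq_square)
    also have "\<dots> = - d\<^sup>2 / (2 * inner h h)"
      using False by (simp add: t_def field_simps power2_eq_square)
    finally have "d\<^sup>2 / (2 * inner h h) \<le> 0"
      using \<open>J u \<le> m\<close> m_le [of "u + t *\<^sub>R h"] by simp
    moreover have "inner h h > 0"
      using False by simp
    ultimately have "d = 0"
      by (simp add: divide_le_0_iff)
    then show ?thesis
      by (simp add: d_def)
  qed (simp add: \<phi>.zero)
  then show thesis
    using that by blast
qed

text \<open>For each \<open>y\<close>, Riesz represents the functional x ->
  \<open>inner y (T x)\<close> by a vector \<open>S y\<close>. The map \<open>S\<close> witnesses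
  the property by which \<open>adjoint\<close> is chosen, so the chosen map has it too.\<close>

lemma adjoint_works_hilbert:
  fixes T :: "'a::{real_inner, complete_space} \<Rightarrow> 'b::real_inner"
  assumes "bounded_linear T"
  shows "inner (adjoint T y) x = inner y (T x)"
proof -
  have "\<exists>u. \<forall>x. inner y (T x) = inner u x" for y
  proof -
    have "bounded_linear (\<lambda>x. inner y (T x))"
      by (rule bounded_linear_compose [OF bounded_linear_inner_right assms])
    then show ?thesis
      by (rule riesz_representation) blast
  qed
  then obtain S where "\<And>y x. inner y (T x) = inner (S y) x"
    by metis
  then have "\<forall>x y. inner (T x) y = inner x (S y)"
    by (simp add: inner_commute)
  then have "\<forall>x y. inner (T x) y = inner x (adjoint T y)"
    unfolding adjoint_def by (rule someI [where P = "\<lambda>S. \<forall>x y. inner (T x) y = inner x (S y)"])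
  then show ?thesis
    by (simp add: inner_commute)
qed

theorem lemma1:
  fixes \<iota> :: "'v::{real_inner, complete_space} \<Rightarrow>\<^sub>L 'x::{real_inner, complete_space}"
    and A\<^sub>0 :: "'x \<Rightarrow>\<^sub>L 'y::{real_inner, complete_space}"
    and A\<^sub>1 A :: "'x \<Rightarrow> 'y"
    and dA :: "'x \<Rightarrow> 'x \<Rightarrow> 'y"
    and \<gamma> \<epsilon> f :: real
    and f\<^sub>\<epsilon> :: "'y \<Rightarrow> real"
    and \<mu> :: "'v \<Rightarrow>\<^sub>L real"
    and y y\<^sub>\<epsilon> \<phi> :: 'y
    and xs x0 :: 'v
  assumes "hilbert_triple \<iota>"
    and "continuously_frechet_differentiable A\<^sub>1"
    and "\<gamma> > 0"
    and "A = (\<lambda>x. blinfun_apply A\<^sub>0 x + \<gamma> *\<^sub>R A\<^sub>1 x)"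
    and "dA = (\<lambda>x. frechet_derivative A (at x))"
    and "\<epsilon> > 0"
    and "norm (y - y\<^sub>\<epsilon>) \<le> \<epsilon>"
    and "A (blinfun_apply \<iota> xs) = y"
    and "f = blinfun_apply \<mu> xs"
    and "f\<^sub>\<epsilon> = (\<lambda>\<psi>. inner \<psi> y\<^sub>\<epsilon>)"
  shows "\<bar>f - f\<^sub>\<epsilon> \<phi>\<bar> \<le>
      \<bar>inner \<phi> (y - y\<^sub>\<epsilon>)\<bar>
    + \<bar>inner \<phi> (A (blinfun_apply \<iota> xs) - A (blinfun_apply \<iota> x0)
        - dA (blinfun_apply \<iota> x0) (blinfun_apply \<iota> xs - blinfun_apply \<iota> x0))\<bar>
    + \<bar>inner \<phi> (A (blinfun_apply \<iota> x0) - dA (blinfun_apply \<iota> x0) (blinfun_apply \<iota> x0))\<bar>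
    + \<bar>blinfun_apply (to_dual \<iota> (adjoint (dA (blinfun_apply \<iota> x0)) \<phi>) - \<mu>) xs\<bar>"
proof -
  let ?D = "dA (blinfun_apply \<iota> x0)"
  have "bounded_linear ?D"
    using frechet_derivative_perturbed [OF assms(2)] assms(4,5)
    by (metis has_derivative_bounded_linear)
  then have "linear ?D" and adj: "inner (adjoint ?D \<phi>) x = inner \<phi> (?D x)" for x
    by (auto intro: bounded_linear.linear adjoint_works_hilbert)
  \<comment> \<open>By \<open>adj\<close>, the pairing in the last term is
    \<open>inner \<phi> (?D (\<iota> xs))\<close> minus \<open>\<mu> xs\<close>. The contributions
    of A(x0), D(x0) and D(xs) then cancel, as does that of y = A(xs), so this is an exact identity
    and only the triangle inequality remains.\<close>
  have "f - f\<^sub>\<epsilon> \<phi> = inner \<phi> (y - y\<^sub>\<epsilon>)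
      - inner \<phi> (A (blinfun_apply \<iota> xs) - A (blinfun_apply \<iota> x0) - ?D (\<iota> xs - \<iota> x0))
      - inner \<phi> (A (blinfun_apply \<iota> x0) - ?D (\<iota> x0))
      - (to_dual \<iota> (adjoint ?D \<phi>) - \<mu>) xs"
    using assms(8-10) by (simp add: adj linear_diff [OF \<open>linear ?D\<close>] blinfun.diff_left inner_diff_right)
  then show ?thesis
    by linarith
qed

end
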